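(* Let $\mathcal{A},\mathcal{B}$ be Lie conformal superalgebras over $\mathbb{C}$ with $\mathcal{A}$ finite and simple, and let $f:\mathcal{A}\to\mathcal{B}$ be a (homogeneous) triple homomorphism. Let $E$ be the enveloping Lie conformal superalgebra of $f(\mathcal{A})$, and assume that $E$ is centerless and can be decomposed into a direct sum of indecomposable ideals. Then $f$ is either a homomorphism, or an anti-homomorphism, or a direct sum of a homomorphism and an anti-homomorphism from $\mathcal{A}$ to $\mathcal{B}$.
   Context: All vector spaces are over $\mathbb{C}$. A Lie conformal superalgebra is a $\mathbb{Z}_2$-graded $\mathbb{C}[\partial]$-module $\mathcal{R}=\mathcal{R}_{\bar 0}\oplus\mathcal{R}_{\bar 1}$ with a $\mathbb{C}$-linear map $\mathcal{R}\otimes\mathcal{R}\to\mathbb{C}[\lambda]\otimes\mathcal{R}$, $a\otimes b\mapsto[a_\lambda b]$, compatible with the grading (the bracket of elements of parities $i,j$ has coefficients of parity $i+j$), such that for homogeneous $a,b,c$ (with parities $|a|,|b|,|c|$): $[\partial a_\lambda b]=-\lambda[a_\lambda b]$, $[a_\lambda\partial b]=(\partial+\lambda)[a_\lambda b]$; $[a_\lambda b]=-(-1)^{|a||b|}[b_{-\lambda-\partial}a]$; $[a_\lambda[b_\mu c]]=[[a_\lambda b]_{\lambda+\mu}c]+(-1)^{|a||b|}[b_\mu[a_\lambda c]]$. Writing $[a_\lambda b]=\sum_n\frac{\lambda^n}{n!}a_{(n)}b$, a subalgebra is a $\mathbb{C}[\partial]$-submodule closed under all products $(n)$, $n\ge0$,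 and an ideal is a $\mathbb{C}[\partial]$-submodule $\mathcal I$ with $a_{(n)}\mathcal I\subseteq\mathcal I$ for all $a\in\mathcal R$, $n\ge0$. $\mathcal{R}$ is finite if it is finitely generated over $\mathbb{C}[\partial]$, simple if it is not abelian (bracket not identically zero) and has no non-trivial ideals, centerless if its center $Z(\mathcal{R})=\{a:[a_\lambda b]=0\ \forall b\in\mathcal{R}\}$ is $0$, and indecomposable if it cannot be written as a direct sum of two nontrivial ideals. A homogeneous $\mathbb{C}[\partial]$-module homomorphism $f:\mathcal{A}\to\mathcal{B}$ (one that maps $\mathcal{A}_i$ into $\mathcal{B}_{i+d}$ for a fixed $d$) is called a homomorphism if $f([a_\lambda b])=[f(a)_\lambda f(b)]$ for all $a,b$; an anti-homomorphism if $f([a_\lambda b])=-[f(a)_\lambda f(b)]$ for all $a,b$; a triple homomorphism if $f([a_\lambda[b_\mu c]])=[f(a)_\lambda[f(b)_\mu f(c)]]$ for all $a,b,c$. For a subset $S$ of a Lie conformal superalgebra, its enveloping Lie conformal superalgebra is the subalgebra generated by $S$. $f$ is called a direct sum of $f_1$ and $f_2$ if $f=f_1+f_2$ and there exist ideals $I_1,I_2$ of the enveloping Lie conformal superalgebra of $f(\mathcal{A})$ with $I_1\cap I_2=0$, $f_1(\mathcal{A})\subseteq I_1$, $f_2(\mathcal{A})\subseteq I_2$. *)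

theory Defs
  imports Complex_Main "HOL-Computational_Algebra.Polynomial" "HOL-Library.Z2"
begin

text \<open>
  The carrier of a superalgebra is the whole type \<open>'a\<close>; its subalgebras and ideals are subsets.
  The space \<open>\<complex>[\<lambda>] \<otimes> R\<close> is \<open>'a poly\<close>, so \<open>lbr A a b\<close> is the polynomial \<open>[a\<^sub>\<lambda> b]\<close> in \<open>\<lambda>\<close> with
  coefficients in \<open>R\<close>. The grading group \<open>\<int>/2\<close> is the type \<open>bit\<close>.
\<close>

record (overloaded) ('a::ab_group_add) lcs =
  smul :: "complex \<Rightarrow> 'a \<Rightarrow> 'a"
  der :: "'a \<Rightarrow> 'a"
  part :: "bit \<Rightarrow> 'a set"
  lbr :: "'a \<Rightarrow> 'a \<Rightarrow> 'a poly"

definition direct_sum2 :: "'a::ab_group_add set \<Rightarrow> 'a set \<Rightarrow> 'a set \<Rightarrow> bool" where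
  "direct_sum2 K I J \<longleftrightarrow> I \<inter> J = {0} \<and> K = {x + y | x y. x \<in> I \<and> y \<in> J}"

definition del_submodule :: "'a::ab_group_add lcs \<Rightarrow> 'a set \<Rightarrow> bool" where
  "del_submodule A N \<longleftrightarrow> module.subspace (smul A) N \<and> (\<forall>x\<in>N. der A x \<in> N)"

text \<open>
  \<open>psubst M \<iota> p\<close> is \<open>\<Sum>\<^sub>n M\<^sup>n (\<iota> p\<^sub>n)\<close>: the operator \<open>M\<close> is substituted for the indeterminate of
  \<open>p = \<Sum>\<^sub>n \<lambda>\<^sup>n p\<^sub>n\<close>, the coefficients being mapped by \<open>\<iota>\<close>.
\<close>

definition psubst :: "('c \<Rightarrow> 'c) \<Rightarrow> ('a \<Rightarrow> 'c) \<Rightarrow> 'a::zero poly \<Rightarrow> 'c::comm_monoid_add" where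
  "psubst M \<iota> p = (\<Sum>n\<le>degree p. (M ^^ n) (\<iota> (coeff p n)))"

text \<open>
  \<open>\<complex>[\<lambda>,\<mu>] \<otimes> R\<close> is \<open>'a poly poly\<close> with outer indeterminate \<open>\<mu>\<close> and inner indeterminate \<open>\<lambda>\<close>;
  \<open>mul_lam\<close> and \<open>mul_mu\<close> are the multiplications by \<open>\<lambda>\<close> and \<open>\<mu>\<close>.
\<close>

definition mul_lam :: "'a::ab_group_add poly poly \<Rightarrow> 'a poly poly" where
  "mul_lam P = map_poly (pCons 0) P"

definition mul_mu :: "'a::ab_group_add poly poly \<Rightarrow> 'a poly poly" where
  "mul_mu P = pCons 0 P"

definition const2 :: "'a::ab_group_add \<Rightarrow> 'a poly poly" where
  "const2 x = [:[:x:]:]"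

text \<open>\<open>[a\<^sub>\<lambda> [b\<^sub>\<mu> c]]\<close>\<close>

definition br_lam_mu :: "'a::ab_group_add lcs \<Rightarrow> 'a \<Rightarrow> 'a \<Rightarrow> 'a \<Rightarrow> 'a poly poly" where
  "br_lam_mu A a b c = psubst mul_mu (\<lambda>x. psubst mul_lam const2 (lbr A a x)) (lbr A b c)"

text \<open>\<open>[b\<^sub>\<mu> [a\<^sub>\<lambda> c]]\<close>\<close>

definition br_mu_lam :: "'a::ab_group_add lcs \<Rightarrow> 'a \<Rightarrow> 'a \<Rightarrow> 'a \<Rightarrow> 'a poly poly" where
  "br_mu_lam A b a c = psubst mul_lam (\<lambda>x. psubst mul_mu const2 (lbr A b x)) (lbr A a c)"

text \<open>\<open>[[a\<^sub>\<lambda> b]\<^bsub>\<lambda>+\<mu>\<^esub> c]\<close>\<close>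

definition br_lam_sum :: "'a::ab_group_add lcs \<Rightarrow> 'a \<Rightarrow> 'a \<Rightarrow> 'a \<Rightarrow> 'a poly poly" where
  "br_lam_sum A a b c =
    psubst mul_lam (\<lambda>x. psubst (\<lambda>P. mul_lam P + mul_mu P) const2 (lbr A x c)) (lbr A a b)"

text \<open>\<open>[b\<^bsub>-\<lambda>-\<partial>\<^esub> a]\<close>, where \<open>\<partial>\<close> acts on the coefficients\<close>

definition br_conj :: "'a::ab_group_add lcs \<Rightarrow> 'a \<Rightarrow> 'a \<Rightarrow> 'a poly" where
  "br_conj A b a = psubst (\<lambda>p. - pCons 0 p - map_poly (der A) p) (\<lambda>x. [:x:]) (lbr A b a)"

definition super_sign :: "bit \<Rightarrow> bit \<Rightarrow> 'c::ab_group_add \<Rightarrow> 'c" where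
  "super_sign i j x = (if i * j = 1 then - x else x)"

locale lie_conformal_superalgebra =
  fixes A :: "'a::ab_group_add lcs"
  assumes vector_space_smul: "vector_space (smul A)"
    and linear_der: "Vector_Spaces.linear (smul A) (smul A) (der A)"
    and part_submodule: "del_submodule A (part A i)"
    and part_direct_sum: "direct_sum2 UNIV (part A 0) (part A 1)"
    and lbr_add_left: "lbr A (a + a') b = lbr A a b + lbr A a' b"
    and lbr_add_right: "lbr A a (b + b') = lbr A a b + lbr A a b'"
    and lbr_smul_left: "lbr A (smul A z a) b = map_poly (smul A z) (lbr A a b)"
    and lbr_smul_right: "lbr A a (smul A z b) = map_poly (smul A z) (lbr A a b)"
    and lbr_graded: "a \<in> part A i \<Longrightarrow> b \<in> part A j \<Longrightarrow> coeff (lbr A a b) n \<in> part A (i + j)"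
    and lbr_der_left: "lbr A (der A a) b = - pCons 0 (lbr A a b)"
    and lbr_der_right: "lbr A a (der A b) = map_poly (der A) (lbr A a b) + pCons 0 (lbr A a b)"
    and skew_symmetry: "a \<in> part A i \<Longrightarrow> b \<in> part A j \<Longrightarrow>
      lbr A a b = - super_sign i j (br_conj A b a)"
    and jacobi: "a \<in> part A i \<Longrightarrow> b \<in> part A j \<Longrightarrow> c \<in> part A k \<Longrightarrow>
      br_lam_mu A a b c = br_lam_sum A a b c + super_sign i j (br_mu_lam A b a c)"

definition nprod :: "'a::ab_group_add lcs \<Rightarrow> nat \<Rightarrow> 'a \<Rightarrow> 'a \<Rightarrow> 'a" where
  "nprod A n a b = smul A (fact n) (coeff (lbr A a b) n)"

definition subalgebra :: "'a::ab_group_add lcs \<Rightarrow> 'a set \<Rightarrow> bool" where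
  "subalgebra A S \<longleftrightarrow> del_submodule A S \<and> (\<forall>n. \<forall>a\<in>S. \<forall>b\<in>S. nprod A n a b \<in> S)"

text \<open>
  In the following notions \<open>K\<close> is a subalgebra of \<open>A\<close>, regarded as an algebra in its own right.
  As in the definition of an ideal as a \<open>\<complex>[\<partial>]\<close>-submodule, compatibility with the grading is not
  required.
\<close>

definition ideal_of :: "'a::ab_group_add lcs \<Rightarrow> 'a set \<Rightarrow> 'a set \<Rightarrow> bool" where
  "ideal_of A K I \<longleftrightarrow>
    I \<subseteq> K \<and> del_submodule A I \<and> (\<forall>n. \<forall>a\<in>K. \<forall>x\<in>I. nprod A n a x \<in> I)"

definition center_of :: "'a::ab_group_add lcs \<Rightarrow> 'a set \<Rightarrow> 'a set" where
  "center_of A K = {a \<in> K. \<forall>b\<in>K. lbr A a b = 0}"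

definition centerless :: "'a::ab_group_add lcs \<Rightarrow> 'a set \<Rightarrow> bool" where
  "centerless A K \<longleftrightarrow> center_of A K = {0}"

definition indecomposable :: "'a::ab_group_add lcs \<Rightarrow> 'a set \<Rightarrow> bool" where
  "indecomposable A K \<longleftrightarrow>
    \<not> (\<exists>I J. ideal_of A K I \<and> ideal_of A K J \<and> I \<noteq> {0} \<and> J \<noteq> {0} \<and> direct_sum2 K I J)"

text \<open>
  \<open>K\<close> is the internal direct sum of the (possibly infinite) family \<open>F\<close>: each element of \<open>K\<close> has a
  unique finitely supported family of components.
\<close>

definition direct_sum_family :: "'a::ab_group_add set \<Rightarrow> 'a set set \<Rightarrow> bool" where
  "direct_sum_family K F \<longleftrightarrow> (\<forall>J\<in>F. J \<subseteq> K) \<and>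
    (\<forall>x\<in>K. \<exists>!g. (\<forall>J\<in>F. g J \<in> J) \<and> (\<forall>J. J \<notin> F \<longrightarrow> g J = 0) \<and>
      finite {J. g J \<noteq> 0} \<and> x = (\<Sum>J | g J \<noteq> 0. g J))"

definition sum_of_indecomposable_ideals :: "'a::ab_group_add lcs \<Rightarrow> 'a set \<Rightarrow> bool" where
  "sum_of_indecomposable_ideals A K \<longleftrightarrow>
    (\<exists>F. (\<forall>J\<in>F. ideal_of A K J \<and> indecomposable A J) \<and> direct_sum_family K F)"

definition finite_lcs :: "'a::ab_group_add lcs \<Rightarrow> bool" where
  "finite_lcs A \<longleftrightarrow> (\<exists>S. finite S \<and> \<Inter>{N. del_submodule A N \<and> S \<subseteq> N} = UNIV)"

definition simple_lcs :: "'a::ab_group_add lcs \<Rightarrow> bool" where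
  "simple_lcs A \<longleftrightarrow>
    (\<exists>a b. lbr A a b \<noteq> 0) \<and> (\<forall>I. ideal_of A UNIV I \<longrightarrow> I = {0} \<or> I = UNIV)"

definition enveloping :: "'a::ab_group_add lcs \<Rightarrow> 'a set \<Rightarrow> 'a set" where
  "enveloping A S = \<Inter>{T. subalgebra A T \<and> S \<subseteq> T}"

definition homogeneous_del_hom ::
    "'a::ab_group_add lcs \<Rightarrow> 'b::ab_group_add lcs \<Rightarrow> ('a \<Rightarrow> 'b) \<Rightarrow> bool" where
  "homogeneous_del_hom A B f \<longleftrightarrow>
    Vector_Spaces.linear (smul A) (smul B) f \<and> (\<forall>x. f (der A x) = der B (f x)) \<and>
    (\<exists>d. \<forall>i. f ` part A i \<subseteq> part B (i + d))"

definition lcs_hom :: "'a::ab_group_add lcs \<Rightarrow> 'b::ab_group_add lcs \<Rightarrow> ('a \<Rightarrow> 'b) \<Rightarrow> bool" where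
  "lcs_hom A B f \<longleftrightarrow> homogeneous_del_hom A B f \<and>
    (\<forall>a b. map_poly f (lbr A a b) = lbr B (f a) (f b))"

definition lcs_anti_hom :: "'a::ab_group_add lcs \<Rightarrow> 'b::ab_group_add lcs \<Rightarrow> ('a \<Rightarrow> 'b) \<Rightarrow> bool" where
  "lcs_anti_hom A B f \<longleftrightarrow> homogeneous_del_hom A B f \<and>
    (\<forall>a b. map_poly f (lbr A a b) = - lbr B (f a) (f b))"

definition lcs_triple_hom :: "'a::ab_group_add lcs \<Rightarrow> 'b::ab_group_add lcs \<Rightarrow> ('a \<Rightarrow> 'b) \<Rightarrow> bool" where
  "lcs_triple_hom A B f \<longleftrightarrow> homogeneous_del_hom A B f \<and>
    (\<forall>a b c. map_poly (map_poly f) (br_lam_mu A a b c) = br_lam_mu B (f a) (f b) (f c))"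

definition direct_sum_map ::
    "'b::ab_group_add lcs \<Rightarrow> ('a \<Rightarrow> 'b) \<Rightarrow> ('a \<Rightarrow> 'b) \<Rightarrow> ('a \<Rightarrow> 'b) \<Rightarrow> bool" where
  "direct_sum_map B f f1 f2 \<longleftrightarrow> (\<forall>x. f x = f1 x + f2 x) \<and>
    (\<exists>I1 I2. ideal_of B (enveloping B (range f)) I1 \<and> ideal_of B (enveloping B (range f)) I2 \<and>
      I1 \<inter> I2 = {0} \<and> range f1 \<subseteq> I1 \<and> range f2 \<subseteq> I2)"

end

theory Submission
  imports Defs "HOL-Library.Set_Algebras"
begin

text \<open>
  A simple algebra is perfect: every \<open>\<partial>\<close>-submodule containing all brackets is the whole algebra.
  Hence, \<open>E\<close> being centerless, each \<open>x\<close> has a unique companion \<open>g x\<close> in \<open>E\<close> with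
  \<open>f [z, x] = [f z, g x]\<close> for all \<open>z\<close>, and \<open>g [a, b] = [f a, f b]\<close>. If \<open>f\<close> is odd, comparing the
  signs in the two skew symmetries forces \<open>f = 0\<close>. If \<open>f\<close> is even, the Jacobi identity makes \<open>g\<close> a
  homomorphism. Then \<open>(f + g) / 2\<close> is a homomorphism, \<open>(f - g) / 2\<close> is an anti-homomorphism, and
  their images commute. So the images are ideals of \<open>E\<close>, and they meet in the center, which is zero.
\<close>

section \<open>Naturality of substitution\<close>

lemma psubst_eq_sum:
  assumes "degree p \<le> N" "M 0 = 0" "\<iota> 0 = 0"
  shows "psubst M \<iota> p = (\<Sum>n\<le>N. (M ^^ n) (\<iota> (coeff p n)))"
proof -
  have "(M ^^ n) 0 = 0" for n
    by (induction n) (auto simp: assms)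
  then show ?thesis
    unfolding psubst_def using assms
    by (intro sum.mono_neutral_left) (auto simp: coeff_eq_0)
qed

lemma psubst_0 [simp]: "\<iota> 0 = 0 \<Longrightarrow> psubst M \<iota> 0 = 0"
  by (simp add: psubst_def)

lemma psubst_natural:
  fixes h :: "'c::ab_group_add \<Rightarrow> 'd::ab_group_add"
  assumes h: "additive h" and M: "\<And>x. h (M x) = M' (h x)" and \<iota>: "\<And>x. h (\<iota> x) = \<iota>' (k x)"
    and "k 0 = 0" "M' 0 = 0" "\<iota>' 0 = 0"
  shows "h (psubst M \<iota> p) = psubst M' \<iota>' (map_poly k p)"
proof -
  have pow: "h ((M ^^ n) x) = (M' ^^ n) (h x)" for n x
    by (induction n) (auto simp: M)
  have "h (psubst M \<iota> p) = (\<Sum>n\<le>degree p. (M' ^^ n) (\<iota>' (k (coeff p n))))"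
    unfolding psubst_def by (simp add: additive.sum[OF h] pow \<iota>)
  also have "\<dots> = psubst M' \<iota>' (map_poly k p)"
    using assms by (subst psubst_eq_sum[where N = "degree p"])
      (auto simp: coeff_map_poly intro!: map_poly_degree_leq)
  finally show ?thesis .
qed

lemma mul_lam_0 [simp]: "mul_lam 0 = 0" and mul_mu_0 [simp]: "mul_mu 0 = 0"
  and const2_0 [simp]: "const2 0 = 0"
  by (simp_all add: mul_lam_def mul_mu_def const2_def)

lemma psubst_mul_lam_const2: "psubst mul_lam const2 p = [:p:]"
proof -
  have pow: "(mul_lam ^^ n) (const2 x) = [:monom x n:]" for n and x :: 'a
    by (induction n) (auto simp: mul_lam_def const2_def map_poly_pCons monom_0 monom_Suc)
  have "[:sum F I:] = (\<Sum>i\<in>I. [:F i:])" for F :: "nat \<Rightarrow> 'a poly" and I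
    by (intro poly_eqI) (simp add: coeff_sum coeff_pCons split: nat.split)
  then show ?thesis
    unfolding psubst_def pow by (metis poly_as_sum_of_monoms)
qed

lemma psubst_mul_mu_pCons:
  fixes h :: "'a::ab_group_add \<Rightarrow> 'b::ab_group_add poly"
  assumes "h 0 = 0"
  shows "psubst mul_mu (\<lambda>x. [:h x:]) p = map_poly h p"
proof -
  have pow: "(mul_mu ^^ n) [:q:] = monom q n" for n and q :: "'b poly"
    by (induction n) (simp_all add: mul_mu_def monom_0 monom_Suc)
  have "psubst mul_mu (\<lambda>x. [:h x:]) p = (\<Sum>n\<le>degree p. monom (coeff (map_poly h p) n) n)"
    by (simp add: psubst_def pow coeff_map_poly assms)
  then show ?thesis
    by (simp add: poly_as_sum_of_monoms' map_poly_degree_leq)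
qed

context additive
begin

lemma additive_map_poly: "additive (map_poly f)"
  by (intro additive.intro poly_eqI) (simp add: coeff_map_poly zero add)

lemma map_poly_mul_lam:
  "map_poly (map_poly f) (mul_lam P) = mul_lam (map_poly (map_poly f) P)"
  unfolding mul_lam_def
  by (intro poly_eqI) (simp add: coeff_map_poly zero coeff_pCons split: nat.split)

lemma map_poly_mul_mu: "map_poly (map_poly f) (mul_mu P) = mul_mu (map_poly (map_poly f) P)"
  unfolding mul_mu_def by (simp add: map_poly_pCons)

lemma map_poly_const2: "map_poly (map_poly f) (const2 x) = const2 (f x)"
  by (simp add: const2_def map_poly_pCons zero)

lemma map_poly_mul_lam_add_mul_mu:
  "map_poly (map_poly f) (mul_lam P + mul_mu P) =
    mul_lam (map_poly (map_poly f) P) + mul_mu (map_poly (map_poly f) P)"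
  by (simp add: additive.add additive.additive_map_poly additive_map_poly
      map_poly_mul_lam map_poly_mul_mu)

lemma map_poly_psubst_const2:
  assumes "\<And>P. map_poly (map_poly f) (M P) = M' (map_poly (map_poly f) P)" and "M' 0 = 0"
  shows "map_poly (map_poly f) (psubst M const2 p) = psubst M' const2 (map_poly f p)"
  using assms by (intro psubst_natural additive.additive_map_poly additive_map_poly)
    (simp_all add: map_poly_const2 zero)

end

section \<open>Submodules, subalgebras and ideals\<close>

definition graded_subset :: "'a::ab_group_add lcs \<Rightarrow> 'a set \<Rightarrow> bool" where
  "graded_subset A S \<longleftrightarrow>
    (\<forall>s\<in>S. \<exists>i. \<exists>t\<in>S \<inter> part A i. \<exists>u\<in>S \<inter> part A (i + 1). s = t + u)"

definition commuting :: "'a::ab_group_add lcs \<Rightarrow> 'a set \<Rightarrow> 'a set \<Rightarrow> bool" where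
  "commuting A M N \<longleftrightarrow> (\<forall>x\<in>M. \<forall>y\<in>N. lbr A x y = 0 \<and> lbr A y x = 0)"

lemma commuting_commute: "commuting A M N \<longleftrightarrow> commuting A N M"
  by (auto simp: commuting_def)

context lie_conformal_superalgebra
begin

sublocale vs: vector_space "smul A"
  by (rule vector_space_smul)

sublocale der: Vector_Spaces.linear "smul A" "smul A" "der A"
  by (rule linear_der)

sublocale lbr_left: additive "\<lambda>a. lbr A a b" for b
  by unfold_locales (rule lbr_add_left)

sublocale lbr_right: additive "lbr A a" for a
  by unfold_locales (rule lbr_add_right)

declare lbr_left.zero [simp] lbr_right.zero [simp]

lemma coeff_lbr_smul:
  "coeff (lbr A (smul A z a) b) n = smul A z (coeff (lbr A a b) n)"
  "coeff (lbr A a (smul A z b)) n = smul A z (coeff (lbr A a b) n)"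
  by (simp_all add: lbr_smul_left lbr_smul_right coeff_map_poly)

lemma eq_minus_self_imp_eq_0:
  fixes x :: 'a
  assumes "x = - x"
  shows "x = 0"
proof -
  have "smul A 2 x = smul A 1 x + smul A 1 x"
    by (simp only: one_add_one flip: vs.scale_left_distrib)
  also have "\<dots> = 0"
    using assms by (metis vs.scale_one add.right_inverse)
  finally show ?thesis by simp
qed

lemma del_submoduleI:
  assumes "0 \<in> N" "\<And>x y. x \<in> N \<Longrightarrow> y \<in> N \<Longrightarrow> x + y \<in> N" "\<And>z x. x \<in> N \<Longrightarrow> smul A z x \<in> N"
    "\<And>x. x \<in> N \<Longrightarrow> der A x \<in> N"
  shows "del_submodule A N"
  using assms by (simp add: del_submodule_def vs.subspaceI)

lemma
  assumes "del_submodule A N"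
  shows del_submodule_zero: "0 \<in> N"
    and del_submodule_add: "x \<in> N \<Longrightarrow> y \<in> N \<Longrightarrow> x + y \<in> N"
    and del_submodule_diff: "x \<in> N \<Longrightarrow> y \<in> N \<Longrightarrow> x - y \<in> N"
    and del_submodule_minus: "x \<in> N \<Longrightarrow> - x \<in> N"
    and del_submodule_smul: "x \<in> N \<Longrightarrow> smul A z x \<in> N"
    and del_submodule_der: "x \<in> N \<Longrightarrow> der A x \<in> N"
  using assms by (auto simp: del_submodule_def vs.subspace_0 vs.subspace_add vs.subspace_diff
      vs.subspace_neg vs.subspace_scale)

lemma del_submodule_singleton_0: "del_submodule A {0}"
  by (simp add: del_submodule_def der.zero)

lemma del_submodule_Inter: "(\<And>N. N \<in> F \<Longrightarrow> del_submodule A N) \<Longrightarrow> del_submodule A (\<Inter>F)"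
  by (simp add: del_submodule_def vs.subspace_Inter)

lemma del_submodule_Int: "del_submodule A M \<Longrightarrow> del_submodule A N \<Longrightarrow> del_submodule A (M \<inter> N)"
  by (simp add: del_submodule_def vs.subspace_inter)

lemma del_submodule_sum:
  assumes "del_submodule A M" "del_submodule A N"
  shows "del_submodule A (M + N)"
proof -
  have "M + N = {x + y |x y. x \<in> M \<and> y \<in> N}"
    by (auto simp: set_plus_def)
  then have "vs.subspace (M + N)"
    using assms by (simp add: del_submodule_def vs.subspace_sums)
  moreover have "der A u \<in> M + N" if "u \<in> M + N" for u
    using that assms
    by (auto simp: der.add del_submodule_der elim!: set_plus_elim intro!: set_plus_intro)
  ultimately show ?thesis
    by (simp add: del_submodule_def)
qed

lemma nprod_mem_iff:
  assumes "del_submodule A N"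
  shows "nprod A n a b \<in> N \<longleftrightarrow> coeff (lbr A a b) n \<in> N"
proof
  assume "nprod A n a b \<in> N"
  then have "smul A (1 / fact n) (nprod A n a b) \<in> N"
    by (rule del_submodule_smul[OF assms])
  then show "coeff (lbr A a b) n \<in> N"
    by (simp add: nprod_def)
qed (simp add: nprod_def del_submodule_smul[OF assms])

lemma subalgebra_iff:
  "subalgebra A S \<longleftrightarrow> del_submodule A S \<and> (\<forall>a\<in>S. \<forall>b\<in>S. \<forall>n. coeff (lbr A a b) n \<in> S)"
  unfolding subalgebra_def using nprod_mem_iff by blast

lemma ideal_of_iff:
  "ideal_of A K I \<longleftrightarrow>
    I \<subseteq> K \<and> del_submodule A I \<and> (\<forall>a\<in>K. \<forall>x\<in>I. \<forall>n. coeff (lbr A a x) n \<in> I)"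
  unfolding ideal_of_def using nprod_mem_iff by blast

lemma subalgebra_imp_del_submodule: "subalgebra A S \<Longrightarrow> del_submodule A S"
  by (simp add: subalgebra_def)

lemma subalgebra_Inter: "(\<And>S. S \<in> F \<Longrightarrow> subalgebra A S) \<Longrightarrow> subalgebra A (\<Inter>F)"
  by (simp add: subalgebra_def del_submodule_Inter)

lemma subalgebra_enveloping: "subalgebra A (enveloping A S)"
  unfolding enveloping_def by (rule subalgebra_Inter) simp

lemma enveloping_superset: "S \<subseteq> enveloping A S"
  by (auto simp: enveloping_def)

lemma enveloping_least: "subalgebra A T \<Longrightarrow> S \<subseteq> T \<Longrightarrow> enveloping A S \<subseteq> T"
  by (auto simp: enveloping_def)

subsection \<open>Sums of commuting subalgebras\<close>

lemma subalgebra_sum_commuting: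
  assumes M: "subalgebra A M" and N: "subalgebra A N" and comm: "commuting A M N"
  shows "subalgebra A (M + N)"
proof -
  have "coeff (lbr A u v) n \<in> M + N" if uv: "u \<in> M + N" "v \<in> M + N" for u v n
  proof -
    obtain x y x' y' where xy: "u = x + y" "x \<in> M" "y \<in> N" "v = x' + y'" "x' \<in> M" "y' \<in> N"
      using uv by (auto elim!: set_plus_elim)
    then have "coeff (lbr A u v) n = coeff (lbr A x x') n + coeff (lbr A y y') n"
      using comm by (simp add: commuting_def lbr_add_left lbr_add_right)
    with xy M N show ?thesis
      by (simp add: subalgebra_iff set_plus_intro)
  qed
  then show ?thesis
    using M N by (simp add: subalgebra_iff del_submodule_sum)
qed

lemma ideal_of_sum_commuting:
  assumes M: "subalgebra A M" and N: "subalgebra A N" and comm: "commuting A M N"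
  shows "ideal_of A (M + N) M"
proof -
  have "coeff (lbr A u x) n \<in> M" if u: "u \<in> M + N" and "x \<in> M" for u x n
  proof -
    obtain y z where "u = y + z" "y \<in> M" "z \<in> N"
      using u by (rule set_plus_elim)
    then show ?thesis
      using M \<open>x \<in> M\<close> comm by (simp add: commuting_def lbr_add_left subalgebra_iff)
  qed
  moreover have "M \<subseteq> M + N"
    using N by (simp add: set_zero_plus2 subalgebra_imp_del_submodule del_submodule_zero
        add.commute[of M])
  ultimately show ?thesis
    using M by (simp add: ideal_of_iff subalgebra_imp_del_submodule)
qed

lemma Int_subset_center_of_sum_commuting:
  assumes M: "subalgebra A M" and N: "subalgebra A N" and comm: "commuting A M N"
  shows "M \<inter> N \<subseteq> center_of A (M + N)"
proof
  fix x assume x: "x \<in> M \<inter> N"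
  have "lbr A x u = 0" if "u \<in> M + N" for u
    using that x comm by (auto simp: commuting_def lbr_add_right elim!: set_plus_elim)
  moreover have "x \<in> M + N"
    using x ideal_of_sum_commuting[OF assms] by (auto simp: ideal_of_iff)
  ultimately show "x \<in> center_of A (M + N)"
    by (simp add: center_of_def)
qed

lemma direct_sum_map_commuting:
  fixes f f1 f2 :: "'b \<Rightarrow> 'a"
  assumes f_eq: "\<And>x. f x = f1 x + f2 x"
    and sub: "subalgebra A (range f1)" "subalgebra A (range f2)"
    and comm: "commuting A (range f1) (range f2)"
    and env: "range f1 \<subseteq> enveloping A (range f)" "range f2 \<subseteq> enveloping A (range f)"
    and centerless: "centerless A (enveloping A (range f))"
  shows "direct_sum_map A f f1 f2"
proof -
  have "range f \<subseteq> range f1 + range f2"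
    by (auto simp: f_eq)
  then have "enveloping A (range f) \<subseteq> range f1 + range f2"
    using subalgebra_sum_commuting[OF sub comm] by (rule enveloping_least[rotated])
  moreover have "range f1 + range f2 \<subseteq> enveloping A (range f)"
    using env del_submodule_add[OF subalgebra_imp_del_submodule[OF subalgebra_enveloping]]
    by (blast elim!: set_plus_elim)
  ultimately have E: "enveloping A (range f) = range f1 + range f2" ..
  have "range f1 \<inter> range f2 \<subseteq> {0}"
    using Int_subset_center_of_sum_commuting[OF sub comm] centerless
    by (simp add: E centerless_def)
  moreover have "0 \<in> range f1 \<inter> range f2"
    using sub by (simp add: subalgebra_imp_del_submodule del_submodule_zero)
  moreover have "ideal_of A (enveloping A (range f)) (range f1)"
    unfolding E using sub comm by (rule ideal_of_sum_commuting)
  moreover have "ideal_of A (enveloping A (range f)) (range f2)"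
    unfolding E add.commute[of "range f1"]
    using sub(2,1) comm[unfolded commuting_commute[of A "range f1"]]
    by (rule ideal_of_sum_commuting)
  ultimately show ?thesis
    unfolding direct_sum_map_def using f_eq by blast
qed

subsection \<open>Homogeneous elements and centralizers\<close>

lemma homogeneous_decomp:
  obtains y z where "y \<in> part A i" "z \<in> part A (i + 1)" "x = y + z"
proof -
  obtain x0 x1 where "x0 \<in> part A 0" "x1 \<in> part A 1" "x = x0 + x1"
    using part_direct_sum unfolding direct_sum2_def by blast
  then show thesis
    using that[of x0 x1] that[of x1 x0] by (cases i) (simp_all add: add.commute)
qed

lemma homogeneous_induct [case_names homogeneous add]:
  assumes "\<And>i x. x \<in> part A i \<Longrightarrow> P x" and "\<And>x y. P x \<Longrightarrow> P y \<Longrightarrow> P (x + y)"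
  shows "P x"
  using homogeneous_decomp assms by metis

lemma homogeneous_induct2 [case_names homogeneous add_left add_right]:
  assumes "\<And>i j x y. x \<in> part A i \<Longrightarrow> y \<in> part A j \<Longrightarrow> P x y"
    and "\<And>x x' y. P x y \<Longrightarrow> P x' y \<Longrightarrow> P (x + x') y"
    and "\<And>x y y'. P x y \<Longrightarrow> P x y' \<Longrightarrow> P x (y + y')"
  shows "P x y"
proof (induction x rule: homogeneous_induct)
  case (homogeneous i x)
  then show ?case
    by (induction y rule: homogeneous_induct) (rule assms; assumption)+
qed (rule assms)

lemma part_Int_trivial:
  assumes "x \<in> part A i" "x \<in> part A (i + 1)"
  shows "x = 0"
  using part_direct_sum assms unfolding direct_sum2_def by (cases i) auto

lemma homogeneous_add_eq_0:
  assumes "x \<in> part A i" "y \<in> part A (i + 1)" "x + y = 0"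
  shows "x = 0" "y = 0"
proof -
  have "y = - x"
    using assms(3) by (simp add: eq_neg_iff_add_eq_0 add.commute)
  with assms show "x = 0"
    by (metis part_Int_trivial part_submodule del_submodule_minus minus_minus)
  with \<open>y = - x\<close> show "y = 0" by simp
qed

lemma coeff_br_lam_mu: "coeff (br_lam_mu A a b c) n = lbr A a (coeff (lbr A b c) n)"
  unfolding br_lam_mu_def psubst_mul_lam_const2
  by (simp add: psubst_mul_mu_pCons coeff_map_poly)

lemma lbr_eq_0_commute:
  assumes "a \<in> part A i" "b \<in> part A j" "lbr A b a = 0"
  shows "lbr A a b = 0"
  using skew_symmetry[OF assms(1,2)] assms(3) by (simp add: super_sign_def br_conj_def)

lemma lbr_eq_0_homogeneous_components:
  assumes a: "a \<in> part A i" and xy: "x \<in> part A j" "y \<in> part A (j + 1)"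
    and sum: "lbr A a (x + y) = 0"
  shows "lbr A a x = 0" "lbr A a y = 0"
proof -
  have "coeff (lbr A a x) n = 0 \<and> coeff (lbr A a y) n = 0" for n
  proof -
    have "coeff (lbr A a x) n \<in> part A (i + j)" "coeff (lbr A a y) n \<in> part A (i + j + 1)"
      using lbr_graded[OF a xy(1)] lbr_graded[OF a xy(2)] by (simp_all only: add.assoc)
    moreover have "coeff (lbr A a x) n + coeff (lbr A a y) n = 0"
      using sum by (metis lbr_add_right coeff_add coeff_0)
    ultimately show ?thesis
      using homogeneous_add_eq_0 by blast
  qed
  then show "lbr A a x = 0" "lbr A a y = 0"
    by (simp_all add: poly_eq_iff)
qed

text \<open>
  Working with the right factor makes the Jacobi identity say \<open>[y\<^sub>\<lambda> [b\<^sub>\<mu> c]] = 0\<close> directly, with no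
  change of variables.
\<close>

lemma subalgebra_centralizer:
  assumes y: "y \<in> part A i"
  shows "subalgebra A {b. lbr A y b = 0}"
proof -
  have homogeneous: "lbr A y (coeff (lbr A b c) n) = 0"
    if "b \<in> part A j" "c \<in> part A k" "lbr A y b = 0" "lbr A y c = 0" for b c j k n
  proof -
    have "br_lam_sum A y b c = 0" "br_mu_lam A b y c = 0"
      using that by (simp_all add: br_lam_sum_def br_mu_lam_def)
    then have "br_lam_mu A y b c = 0"
      using jacobi[OF y that(1,2)] by (simp add: super_sign_def)
    then show ?thesis
      by (metis coeff_br_lam_mu coeff_0)
  qed
  have "lbr A y (coeff (lbr A b c) n) = 0" if bc: "lbr A y b = 0" "lbr A y c = 0" for b c n
  proof -
    obtain b0 b1 where b: "b0 \<in> part A i" "b1 \<in> part A (i + 1)" "b = b0 + b1"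
      by (rule homogeneous_decomp)
    obtain c0 c1 where c: "c0 \<in> part A i" "c1 \<in> part A (i + 1)" "c = c0 + c1"
      by (rule homogeneous_decomp)
    have "lbr A y b0 = 0" "lbr A y b1 = 0" "lbr A y c0 = 0" "lbr A y c1 = 0"
      using lbr_eq_0_homogeneous_components[OF y] b c bc by blast+
    with b c show ?thesis
      by (simp add: lbr_add_left lbr_add_right homogeneous)
  qed
  moreover have "del_submodule A {b. lbr A y b = 0}"
    by (rule del_submoduleI) (auto simp: lbr_add_right lbr_smul_right lbr_der_right)
  ultimately show ?thesis
    by (simp add: subalgebra_iff)
qed

lemma center_of_envelopingI:
  assumes S: "graded_subset A S"
    and y: "y \<in> enveloping A S" and comm: "\<And>s. s \<in> S \<Longrightarrow> lbr A s y = 0"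
  shows "y \<in> center_of A (enveloping A S)"
proof -
  obtain y0 y1 where y01: "y0 \<in> part A 0" "y1 \<in> part A 1" "y = y0 + y1"
    using homogeneous_decomp[where i = 0] by auto
  have homogeneous: "lbr A y0 s = 0 \<and> lbr A y1 s = 0" if s: "s \<in> S" "s \<in> part A i" for s i
  proof -
    have "lbr A s y0 = 0" "lbr A s y1 = 0"
      using lbr_eq_0_homogeneous_components[of s i y0 0 y1] s comm y01 by simp_all
    with y01 s(2) show ?thesis
      by (blast intro: lbr_eq_0_commute)
  qed
  have "lbr A y0 s = 0 \<and> lbr A y1 s = 0" if s: "s \<in> S" for s
  proof -
    obtain i t u where "t \<in> S \<inter> part A i" "u \<in> S \<inter> part A (i + 1)" "s = t + u"
      using S s unfolding graded_subset_def by blast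
    then show ?thesis
      using homogeneous[of t i] homogeneous[of u "i + 1"] by (simp add: lbr_add_right)
  qed
  then have "enveloping A S \<subseteq> {b. lbr A y0 b = 0}" "enveloping A S \<subseteq> {b. lbr A y1 b = 0}"
    using subalgebra_centralizer[OF y01(1)] subalgebra_centralizer[OF y01(2)]
    by (intro enveloping_least; blast)+
  then show ?thesis
    using y y01(3) by (auto simp: center_of_def lbr_add_left subset_iff)
qed

lemma sum_part_eq_UNIV_imp_eq_part:
  assumes M: "M \<subseteq> part A i" and UNIV: "M + part A (i + 1) = UNIV"
  shows "M = part A i"
proof
  show "part A i \<subseteq> M"
  proof
    fix x assume x: "x \<in> part A i"
    obtain y z where y: "y \<in> M" and z: "z \<in> part A (i + 1)" "x = y + z"
      using UNIV by (metis UNIV_I set_plus_elim)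
    then have "z \<in> part A i"
      using M del_submodule_diff[OF part_submodule x, of y] by auto
    with y z show "x \<in> M"
      using part_Int_trivial by fastforce
  qed
qed (rule M)

subsection \<open>Perfectness of simple algebras\<close>

lemma simple_del_submodule_eq_UNIV:
  assumes "simple_lcs A" "del_submodule A N" "\<And>a b n. coeff (lbr A a b) n \<in> N"
  shows "N = UNIV"
proof -
  have "ideal_of A UNIV N"
    using assms by (simp add: ideal_of_iff)
  moreover have "N \<noteq> {0}"
    using assms(1,3) unfolding simple_lcs_def by (metis poly_eqI coeff_0 singletonD)
  ultimately show ?thesis
    using assms(1) by (auto simp: simple_lcs_def)
qed

lemma simple_part_subset:
  assumes "simple_lcs A" and N: "del_submodule A N"
    and br: "\<And>a b i j n. a \<in> part A i \<Longrightarrow> b \<in> part A j \<Longrightarrow> i + j = k \<Longrightarrow> coeff (lbr A a b) n \<in> N"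
  shows "part A k \<subseteq> N"
proof -
  let ?S = "part A k \<inter> N + part A (k + 1)"
  have S: "del_submodule A ?S"
    by (intro del_submodule_sum del_submodule_Int part_submodule N)
  have "coeff (lbr A a b) n \<in> ?S" for a b n
  proof (induction a b rule: homogeneous_induct2)
    case (homogeneous i j a b)
    show ?case
    proof (cases "i + j = k")
      case True
      then have "coeff (lbr A a b) n \<in> part A k \<inter> N"
        using br lbr_graded homogeneous by blast
      then have "coeff (lbr A a b) n + 0 \<in> ?S"
        using del_submodule_zero[OF part_submodule] by (rule set_plus_intro)
      then show ?thesis by simp
    next
      case False
      then have "i + j = k + 1"
        by (cases i; cases j; cases k) auto
      then have "coeff (lbr A a b) n \<in> part A (k + 1)"
        using lbr_graded[OF homogeneous] by metis
      then have "0 + coeff (lbr A a b) n \<in> ?S"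
        using del_submodule_zero[OF del_submodule_Int[OF part_submodule N]]
        by (rule set_plus_intro[rotated])
      then show ?thesis by simp
    qed
  qed (simp_all only: lbr_add_left lbr_add_right coeff_add del_submodule_add[OF S])
  then have "?S = UNIV"
    using assms(1) S by (intro simple_del_submodule_eq_UNIV)
  then have "part A k \<inter> N = part A k"
    by (intro sum_part_eq_UNIV_imp_eq_part) auto
  then show ?thesis by blast
qed

end

section \<open>Homomorphisms of \<open>\<complex>[\<partial>]\<close>-modules\<close>

locale del_hom = A: lie_conformal_superalgebra A + B: lie_conformal_superalgebra B + additive h
  for A :: "'a::ab_group_add lcs" and B :: "'b::ab_group_add lcs" and h :: "'a \<Rightarrow> 'b" +
  assumes smul: "h (smul A z x) = smul B z (h x)"
    and der: "h (der A x) = der B (h x)"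
begin

lemma linear: "Vector_Spaces.linear (smul A) (smul B) h"
  by (simp add: Vector_Spaces.linear_iff A.vector_space_smul B.vector_space_smul add smul)

sublocale linear: Vector_Spaces.linear "smul A" "smul B" h
  by (rule linear)

sublocale map_poly: additive "map_poly h"
  by (rule additive_map_poly)

sublocale map_poly_map_poly: additive "map_poly (map_poly h)"
  by (rule map_poly.additive_map_poly)

lemma map_poly_eq_iff: "map_poly h p = q \<longleftrightarrow> (\<forall>n. h (coeff p n) = coeff q n)"
  by (simp add: poly_eq_iff coeff_map_poly zero)

lemma map_poly_map_poly_eq_iff:
  "map_poly (map_poly h) P = Q \<longleftrightarrow> (\<forall>n. map_poly h (coeff P n) = coeff Q n)"
  by (simp add: poly_eq_iff[of _ Q] coeff_map_poly map_poly.zero)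

lemma del_submodule_range: "del_submodule B (range h)"
  using linear.subspace_image[OF A.vs.subspace_UNIV]
  by (auto simp: del_submodule_def simp flip: der)

lemma del_submodule_vimage: "del_submodule B N \<Longrightarrow> del_submodule A (h -` N)"
  using linear.subspace_vimage by (simp add: del_submodule_def der)

lemma del_submodule_kernel: "del_submodule A (h -` {0})"
  by (rule del_submodule_vimage[OF B.del_submodule_singleton_0])

lemma subalgebra_range_lcs_hom:
  assumes "lcs_hom A B h"
  shows "subalgebra B (range h)"
  using assms del_submodule_range unfolding lcs_hom_def B.subalgebra_iff map_poly_eq_iff
  by (auto intro: range_eqI[OF sym])

lemma subalgebra_range_lcs_anti_hom:
  assumes "lcs_anti_hom A B h"
  shows "subalgebra B (range h)"
proof -
  have "coeff (lbr B (h a) (h b)) n = h (- coeff (lbr A a b) n)" for a b n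
    using assms by (simp add: lcs_anti_hom_def map_poly_eq_iff minus)
  then show ?thesis
    by (auto simp: B.subalgebra_iff del_submodule_range)
qed

lemma br_lam_sum_natural:
  assumes k: "k 0 = 0"
    and inner: "\<And>w. map_poly h (lbr A w c) = lbr B (k w) c'"
    and outer: "map_poly k (lbr A a b) = lbr B a' b'"
  shows "map_poly (map_poly h) (br_lam_sum A a b c) = br_lam_sum B a' b' c'"
proof -
  have "map_poly (map_poly h) (psubst (\<lambda>P. mul_lam P + mul_mu P) const2 (lbr A w c)) =
      psubst (\<lambda>P. mul_lam P + mul_mu P) const2 (lbr B (k w) c')" for w
    unfolding inner[symmetric]
    by (intro map_poly_psubst_const2 map_poly_mul_lam_add_mul_mu) simp
  then show ?thesis
    unfolding br_lam_sum_def outer[symmetric]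
    by (intro psubst_natural map_poly.additive_map_poly map_poly_mul_lam) (simp_all add: k)
qed

lemma br_mu_lam_natural:
  assumes k: "k 0 = 0"
    and inner: "\<And>w. map_poly h (lbr A b w) = lbr B b' (k w)"
    and outer: "map_poly k (lbr A a c) = lbr B a' c'"
  shows "map_poly (map_poly h) (br_mu_lam A b a c) = br_mu_lam B b' a' c'"
proof -
  have "map_poly (map_poly h) (psubst mul_mu const2 (lbr A b w)) =
      psubst mul_mu const2 (lbr B b' (k w))" for w
    unfolding inner[symmetric] by (intro map_poly_psubst_const2 map_poly_mul_mu) simp
  then show ?thesis
    unfolding br_mu_lam_def outer[symmetric]
    by (intro psubst_natural map_poly.additive_map_poly map_poly_mul_lam) (simp_all add: k)
qed

lemma br_conj_natural:
  assumes "map_poly h (lbr A b a) = lbr B b' a'"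
  shows "map_poly h (br_conj A b a) = br_conj B b' a'"
proof -
  have "map_poly h (- pCons 0 p - map_poly (der A) p) =
      - pCons 0 (map_poly h p) - map_poly (der B) (map_poly h p)" for p
    by (simp add: map_poly_eq_iff coeff_map_poly A.der.zero B.der.zero zero diff minus der
        coeff_pCons split: nat.split)
  then show ?thesis
    unfolding br_conj_def assms[symmetric]
    by (intro psubst_natural) (simp_all add: additive_map_poly map_poly_pCons zero)
qed

lemma map_poly_super_sign: "map_poly h (super_sign i j p) = super_sign i j (map_poly h p)"
  by (simp add: super_sign_def map_poly.minus)

lemma skew_symmetry_natural:
  assumes "a \<in> part A i" "b \<in> part A j" "a' \<in> part B i'" "b' \<in> part B j'"
    and "map_poly h (lbr A b a) = lbr B b' a'"
  shows "map_poly h (lbr A a b) = super_sign i j (super_sign i' j' (lbr B a' b'))"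
  using A.skew_symmetry[OF assms(1,2)] B.skew_symmetry[OF assms(3,4)] br_conj_natural[OF assms(5)]
  by (simp add: map_poly_super_sign map_poly.minus) (simp add: super_sign_def)

definition intertwines_right :: "'a \<Rightarrow> 'b \<Rightarrow> bool" where
  "intertwines_right x y \<longleftrightarrow> (\<forall>z. map_poly h (lbr A z x) = lbr B (h z) y)"

lemma intertwines_right_zero: "intertwines_right 0 0"
  by (simp add: intertwines_right_def)

lemma intertwines_right_add:
  "intertwines_right x y \<Longrightarrow> intertwines_right x' y' \<Longrightarrow> intertwines_right (x + x') (y + y')"
  by (simp add: intertwines_right_def A.lbr_add_right B.lbr_add_right map_poly.add)

lemma intertwines_right_smul:
  "intertwines_right x y \<Longrightarrow> intertwines_right (smul A c x) (smul B c y)"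
  by (simp add: intertwines_right_def map_poly_eq_iff smul
      A.coeff_lbr_smul B.coeff_lbr_smul)

lemma intertwines_right_der:
  "intertwines_right x y \<Longrightarrow> intertwines_right (der A x) (der B y)"
  by (simp add: intertwines_right_def map_poly_eq_iff A.lbr_der_right B.lbr_der_right
      coeff_map_poly A.der.zero B.der.zero add zero der coeff_pCons split: nat.split)

end

locale even_del_hom = del_hom +
  assumes part: "x \<in> part A i \<Longrightarrow> h x \<in> part B i"
begin

lemma homogeneous_del_hom: "homogeneous_del_hom A B h"
proof -
  have "h ` part A i \<subseteq> part B (i + 0)" for i
    using part by (simp only: add_0_right) blast
  then show ?thesis
    using linear der by (auto simp only: homogeneous_del_hom_def)
qed

lemma intertwines_right_imp_left:
  assumes "x \<in> part A i" "y \<in> part B i" and "intertwines_right x y"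
  shows "map_poly h (lbr A x z) = lbr B y (h z)"
proof (induction z rule: A.homogeneous_induct)
  case (homogeneous j z)
  then have "map_poly h (lbr A x z) = super_sign i j (super_sign i j (lbr B y (h z)))"
    using assms part by (intro skew_symmetry_natural) (auto simp: intertwines_right_def)
  then show ?case
    by (simp add: super_sign_def)
qed (simp add: A.lbr_add_right B.lbr_add_right map_poly.add add)

text \<open>\<open>h\<close> carries the Jacobi identity for \<open>z, x, x'\<close> in \<open>A\<close> to that for \<open>h z, y, y'\<close> in \<open>B\<close>.\<close>

lemma intertwines_right_lbr:
  assumes "x \<in> part A i" "y \<in> part B i" "intertwines_right x y"
    and "x' \<in> part A j" "y' \<in> part B j" "intertwines_right x' y'"
  shows "intertwines_right (coeff (lbr A x x') n) (coeff (lbr B y y') n)"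
proof -
  note right = assms(3,6)[unfolded intertwines_right_def, rule_format]
  have "map_poly h (lbr A z (coeff (lbr A x x') n)) = lbr B (h z) (coeff (lbr B y y') n)" for z
  proof (induction z rule: A.homogeneous_induct)
    case (homogeneous k z)
    have "map_poly (map_poly h) (br_lam_sum A z x x') = br_lam_sum B (h z) y y'"
      by (rule br_lam_sum_natural[where k = h]) (rule zero right)+
    moreover have "map_poly (map_poly h) (br_mu_lam A x z x') = br_mu_lam B y (h z) y'"
      by (rule br_mu_lam_natural[where k = h])
        (rule zero right intertwines_right_imp_left[OF assms(1-3)])+
    ultimately have "map_poly (map_poly h) (br_lam_mu A z x x') = br_lam_mu B (h z) y y'"
      using A.jacobi[OF homogeneous assms(1,4)] B.jacobi[OF part[OF homogeneous] assms(2,5)]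
      by (simp add: super_sign_def map_poly_map_poly.add map_poly_map_poly.minus)
    then show ?case
      by (simp add: map_poly_map_poly_eq_iff A.coeff_br_lam_mu B.coeff_br_lam_mu)
  qed (simp add: A.lbr_add_left B.lbr_add_left map_poly.add add)
  then show ?thesis
    by (simp add: intertwines_right_def)
qed

end

section \<open>The companion of a triple homomorphism\<close>

locale centerless_triple_hom =
  A: lie_conformal_superalgebra A + B: lie_conformal_superalgebra B
  for A :: "'a::ab_group_add lcs" and B :: "'b::ab_group_add lcs" +
  fixes f :: "'a \<Rightarrow> 'b" and d :: bit
  assumes simple: "simple_lcs A"
    and triple_hom: "lcs_triple_hom A B f"
    and parity: "f ` part A i \<subseteq> part B (i + d)"
    and centerless: "centerless B (enveloping B (range f))"
begin

lemma homogeneous_del_hom_f: "homogeneous_del_hom A B f"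
  using triple_hom by (simp add: lcs_triple_hom_def)

sublocale f: del_hom A B f
  using homogeneous_del_hom_f unfolding homogeneous_del_hom_def Vector_Spaces.linear_iff
  by unfold_locales simp_all

abbreviation E :: "'b set" where
  "E \<equiv> enveloping B (range f)"

lemma f_part: "x \<in> part A i \<Longrightarrow> f x \<in> part B (i + d)"
  using parity by blast

lemma f_in_E: "f x \<in> E"
  using B.enveloping_superset by blast

lemma subalgebra_E: "subalgebra B E"
  by (rule B.subalgebra_enveloping)

lemmas del_submodule_E = B.subalgebra_imp_del_submodule[OF subalgebra_E]

lemmas E_closed = f_in_E B.del_submodule_zero[OF del_submodule_E]
  B.del_submodule_add[OF del_submodule_E] B.del_submodule_diff[OF del_submodule_E]
  B.del_submodule_smul[OF del_submodule_E] B.del_submodule_der[OF del_submodule_E]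

lemma coeff_lbr_in_E: "u \<in> E \<Longrightarrow> v \<in> E \<Longrightarrow> coeff (lbr B u v) n \<in> E"
  using subalgebra_E by (simp add: B.subalgebra_iff)

lemma graded_subset_range_f: "graded_subset B (range f)"
  unfolding graded_subset_def
proof
  fix s assume "s \<in> range f"
  then obtain x where "s = f x" by blast
  moreover obtain y z where yz: "y \<in> part A d" "z \<in> part A (d + 1)" "x = y + z"
    by (rule A.homogeneous_decomp)
  ultimately have "s = f y + f z"
    by (simp add: f.add)
  moreover have "f y \<in> part B (d + d)" "f z \<in> part B (d + d + 1)"
    using f_part[OF yz(1)] f_part[OF yz(2)] by (simp_all only: ac_simps)
  ultimately show "\<exists>i. \<exists>t\<in>range f \<inter> part B i. \<exists>u\<in>range f \<inter> part B (i + 1). s = t + u"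
    by blast
qed

lemma centralizer_trivial:
  assumes "y \<in> E" "\<And>z. lbr B (f z) y = 0"
  shows "y = 0"
  using B.center_of_envelopingI[OF graded_subset_range_f assms(1)] assms(2) centerless
  by (auto simp: centerless_def)

definition companion :: "'a \<Rightarrow> 'b \<Rightarrow> bool" where
  "companion x y \<longleftrightarrow> y \<in> E \<and> f.intertwines_right x y"

lemma companion_unique:
  assumes "companion x y" "companion x y'"
  shows "y = y'"
proof -
  have "lbr B (f z) (y - y') = 0" for z
    using assms by (simp add: companion_def f.intertwines_right_def B.lbr_right.diff)
  then have "y - y' = 0"
    using assms by (intro centralizer_trivial E_closed) (simp_all add: companion_def)
  then show ?thesis by simp
qed

lemma companion_lbr: "companion (coeff (lbr A a b) n) (coeff (lbr B (f a) (f b)) n)"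
  using triple_hom by (simp add: companion_def coeff_lbr_in_E f_in_E f.intertwines_right_def
      lcs_triple_hom_def f.map_poly_map_poly_eq_iff A.coeff_br_lam_mu B.coeff_br_lam_mu)

lemma companion_zero: "companion 0 0"
  and companion_add: "companion x y \<Longrightarrow> companion x' y' \<Longrightarrow> companion (x + x') (y + y')"
  and companion_smul: "companion x y \<Longrightarrow> companion (smul A c x) (smul B c y)"
  and companion_der: "companion x y \<Longrightarrow> companion (der A x) (der B y)"
  by (simp_all add: companion_def E_closed f.intertwines_right_zero f.intertwines_right_add
      f.intertwines_right_smul f.intertwines_right_der)

lemma companion_exists: "\<exists>y. companion x y"
proof -
  have "del_submodule A {x. \<exists>y. companion x y}"
    by (rule A.del_submoduleI)
      (blast intro: companion_zero companion_add companion_smul companion_der)+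
  then have "{x. \<exists>y. companion x y} = UNIV"
    by (rule A.simple_del_submodule_eq_UNIV[OF simple]) (blast intro: companion_lbr)
  then show ?thesis by blast
qed

definition g :: "'a \<Rightarrow> 'b" where
  "g x = (THE y. companion x y)"

lemma companion_g: "companion x (g x)"
  unfolding g_def using companion_exists companion_unique by (metis the_equality)

lemma g_eqI: "companion x y \<Longrightarrow> g x = y"
  using companion_g companion_unique by blast

lemma g_in_E: "g x \<in> E"
  using companion_g by (simp add: companion_def)

lemma intertwines_right_g: "f.intertwines_right x (g x)"
  using companion_g by (simp add: companion_def)

lemma map_f_lbr: "map_poly f (lbr A z x) = lbr B (f z) (g x)"
  using intertwines_right_g by (simp add: f.intertwines_right_def)

sublocale g: del_hom A B g
  by unfold_locales (intro g_eqI companion_add companion_smul companion_der companion_g)+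

lemma map_g_lbr: "map_poly g (lbr A a b) = lbr B (f a) (f b)"
  by (simp add: g.map_poly_eq_iff g_eqI[OF companion_lbr])

sublocale g: even_del_hom A B g
proof
  fix x i assume "x \<in> part A i"
  moreover have "part A i \<subseteq> g -` part B i"
  proof (rule A.simple_part_subset[OF simple g.del_submodule_vimage[OF B.part_submodule]])
    fix a b j k n assume ab: "a \<in> part A j" "b \<in> part A k" and "j + k = i"
    have "coeff (lbr B (f a) (f b)) n \<in> part B ((j + d) + (k + d))"
      using f_part[OF ab(1)] f_part[OF ab(2)] by (rule B.lbr_graded)
    moreover have "(j + d) + (k + d) = i"
      using \<open>j + k = i\<close> by (cases d) (auto simp: ac_simps)
    ultimately show "coeff (lbr A a b) n \<in> g -` part B i"
      by (simp add: g_eqI[OF companion_lbr])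
  qed
  ultimately show "g x \<in> part B i" by blast
qed

end

section \<open>Odd triple homomorphisms\<close>

locale odd_triple_hom = centerless_triple_hom where d = 1
begin

text \<open>
  The skew symmetries of \<open>A\<close> and of \<open>B\<close> carry opposite signs on brackets of elements of equal
  parity.
\<close>

lemma g_lbr_equal_parity:
  assumes "a \<in> part A i" "b \<in> part A i"
  shows "g (coeff (lbr A a b) n) = 0"
proof -
  have "map_poly g (lbr A a b) =
      super_sign i i (super_sign (i + 1) (i + 1) (lbr B (f a) (f b)))"
    using assms by (intro g.skew_symmetry_natural f_part map_g_lbr)
  then have "map_poly g (lbr A a b) = - map_poly g (lbr A a b)"
    by (cases i) (simp_all add: map_g_lbr super_sign_def)
  then have "g (coeff (lbr A a b) n) = - g (coeff (lbr A a b) n)"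
    by (metis coeff_map_poly coeff_minus g.zero)
  then show ?thesis
    by (rule B.eq_minus_self_imp_eq_0)
qed

lemma g_even_part:
  assumes "x \<in> part A 0"
  shows "g x = 0"
proof -
  have "part A 0 \<subseteq> g -` {0}"
  proof (rule A.simple_part_subset[OF simple g.del_submodule_kernel])
    fix a b i j n assume "a \<in> part A i" "b \<in> part A j" "i + j = 0"
    then show "coeff (lbr A a b) n \<in> g -` {0}"
      using g_lbr_equal_parity by (cases i; cases j) auto
  qed
  with assms show ?thesis by blast
qed

lemma f_lbr_even_right: "b \<in> part A 0 \<Longrightarrow> f (coeff (lbr A a b) n) = 0"
  using map_f_lbr[of a b] by (simp add: f.map_poly_eq_iff g_even_part)

lemma f_lbr_even_left:
  assumes "a \<in> part A 0" "b \<in> part A j"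
  shows "f (coeff (lbr A a b) n) = 0"
proof -
  have "map_poly f (lbr A a b) = super_sign 0 j (super_sign 0 (j + 1) (lbr B 0 (f b)))"
    using assms map_f_lbr[of b a]
    by (intro f.skew_symmetry_natural f_part B.del_submodule_zero B.part_submodule)
      (simp_all add: g_even_part)
  then show ?thesis
    by (simp add: f.map_poly_eq_iff super_sign_def)
qed

lemma f_odd_part:
  assumes "x \<in> part A 1"
  shows "f x = 0"
proof -
  have "part A 1 \<subseteq> f -` {0}"
  proof (rule A.simple_part_subset[OF simple f.del_submodule_kernel])
    fix a b i j n assume "a \<in> part A i" "b \<in> part A j" "i + j = 1"
    then show "coeff (lbr A a b) n \<in> f -` {0}"
      using f_lbr_even_left f_lbr_even_right by (cases i; cases j) auto
  qed
  with assms show ?thesis by blast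
qed

lemma f_eq_0: "f x = 0"
proof -
  have "f (coeff (lbr A a b) n) = 0" for a b n
  proof (induction a rule: A.homogeneous_induct)
    case (homogeneous i a)
    show ?case
    proof (cases i)
      case zero
      with homogeneous show ?thesis
        using f_lbr_even_left by (induction b rule: A.homogeneous_induct)
          (auto simp: A.lbr_add_right f.add)
    next
      case one
      with homogeneous show ?thesis
        using map_f_lbr[of a b] by (simp add: f.map_poly_eq_iff f_odd_part)
    qed
  qed (simp add: A.lbr_add_left f.add)
  then have "f -` {0} = UNIV"
    by (intro A.simple_del_submodule_eq_UNIV[OF simple f.del_submodule_kernel]) simp
  then show ?thesis by blast
qed

lemma lcs_hom_f: "lcs_hom A B f"
  using homogeneous_del_hom_f by (simp add: lcs_hom_def f.map_poly_eq_iff f_eq_0)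

end

section \<open>Splitting an even triple homomorphism\<close>

locale even_triple_hom = centerless_triple_hom where d = 0
begin

sublocale f: even_del_hom A B f
  by unfold_locales (metis f_part add_0_right)

lemma map_f_lbr_flip: "map_poly f (lbr A x z) = lbr B (g x) (f z)"
proof (induction x rule: A.homogeneous_induct)
  case (homogeneous i x)
  then show ?case
    by (intro f.intertwines_right_imp_left intertwines_right_g g.part)
qed (simp add: A.lbr_add_left B.lbr_add_left f.map_poly.add g.add)

lemma map_g_lbr_hom: "map_poly g (lbr A x y) = lbr B (g x) (g y)"
proof (induction x y rule: A.homogeneous_induct2)
  case (homogeneous i j x y)
  have "companion (coeff (lbr A x y) n) (coeff (lbr B (g x) (g y)) n)" for n
    unfolding companion_def using homogeneous
    by (intro conjI coeff_lbr_in_E g_in_E f.intertwines_right_lbr g.part intertwines_right_g)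
  then show ?case
    by (simp add: g.map_poly_eq_iff g_eqI)
qed (simp_all add: A.lbr_add_left A.lbr_add_right B.lbr_add_left B.lbr_add_right
    g.map_poly.add g.add)

definition half_sum :: "complex \<Rightarrow> 'a \<Rightarrow> 'b" where
  "half_sum s x = smul B (1/2) (f x + smul B s (g x))"

sublocale half_sum: even_del_hom A B "half_sum s" for s
proof
  show "half_sum s (x + y) = half_sum s x + half_sum s y" for x y
    by (simp add: half_sum_def f.add g.add B.vs.scale_right_distrib)
  show "half_sum s (smul A z x) = smul B z (half_sum s x)" for z x
    by (simp add: half_sum_def f.smul g.smul B.vs.scale_right_distrib mult.left_commute[of z])
  show "half_sum s (der A x) = der B (half_sum s x)" for x
    by (simp add: half_sum_def f.der g.der B.der.add B.der.scale)
  show "half_sum s x \<in> part B i" if "x \<in> part A i" for x i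
    unfolding half_sum_def using that
    by (intro B.del_submodule_smul B.del_submodule_add B.part_submodule f.part g.part)
qed

lemma half_sum_in_E: "half_sum s x \<in> E"
  by (simp add: half_sum_def E_closed g_in_E)

lemma f_eq_half_sums: "f x = half_sum 1 x + half_sum (- 1) x"
proof -
  have "half_sum 1 x + half_sum (- 1) x = smul B (1/2 + 1/2) (f x)"
    unfolding half_sum_def B.vs.scale_left_distrib
    by (simp add: B.vs.scale_right_distrib B.vs.scale_right_diff_distrib)
  then show ?thesis by simp
qed

lemma coeff_lbr_half_sum:
  "coeff (lbr B (half_sum s x) (half_sum t y)) n =
    smul B ((1 + s * t) / 4) (g (coeff (lbr A x y) n)) +
    smul B ((s + t) / 4) (f (coeff (lbr A x y) n))"
proof -
  have "f (coeff (lbr A x y) n) = coeff (lbr B (f x) (g y)) n"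
    "f (coeff (lbr A x y) n) = coeff (lbr B (g x) (f y)) n"
    using map_f_lbr map_f_lbr_flip by (simp_all only: f.map_poly_eq_iff)
  moreover have "g (coeff (lbr A x y) n) = coeff (lbr B (f x) (f y)) n"
    "g (coeff (lbr A x y) n) = coeff (lbr B (g x) (g y)) n"
    using map_g_lbr map_g_lbr_hom by (simp_all only: g.map_poly_eq_iff)
  ultimately show ?thesis
    by (simp add: half_sum_def B.coeff_lbr_smul B.lbr_add_left B.lbr_add_right
        B.vs.scale_right_distrib B.vs.scale_left_distrib add_divide_distrib algebra_simps)
qed

lemma coeff_lbr_half_sum_same_sign:
  assumes "s * s = 1"
  shows "coeff (lbr B (half_sum s x) (half_sum s y)) n =
    smul B s (half_sum s (coeff (lbr A x y) n))"
  unfolding coeff_lbr_half_sum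
  by (simp add: half_sum_def assms B.vs.scale_right_distrib algebra_simps)

lemma lbr_half_sum_opposite_sign:
  assumes "s * s = 1"
  shows "lbr B (half_sum s x) (half_sum (- s) y) = 0"
  by (simp add: poly_eq_iff coeff_lbr_half_sum assms)

lemma lcs_hom_half_sum: "lcs_hom A B (half_sum 1)"
  by (simp add: lcs_hom_def half_sum.homogeneous_del_hom half_sum.map_poly_eq_iff
      coeff_lbr_half_sum_same_sign)

lemma lcs_anti_hom_half_sum: "lcs_anti_hom A B (half_sum (- 1))"
  by (simp add: lcs_anti_hom_def half_sum.homogeneous_del_hom half_sum.map_poly_eq_iff
      coeff_lbr_half_sum_same_sign)

lemma commuting_range_half_sums: "commuting B (range (half_sum 1)) (range (half_sum (- 1)))"
  using lbr_half_sum_opposite_sign[of 1] lbr_half_sum_opposite_sign[of "- 1"]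
  by (auto simp: commuting_def)

lemma direct_sum_map_half_sums: "direct_sum_map B f (half_sum 1) (half_sum (- 1))"
  using f_eq_half_sums half_sum.subalgebra_range_lcs_hom[OF lcs_hom_half_sum]
    half_sum.subalgebra_range_lcs_anti_hom[OF lcs_anti_hom_half_sum] commuting_range_half_sums
  by (rule B.direct_sum_map_commuting) (use half_sum_in_E centerless in auto)

end

theorem theorem6p8:
  fixes A :: "'a::ab_group_add lcs" and B :: "'b::ab_group_add lcs" and f :: "'a \<Rightarrow> 'b"
  assumes "lie_conformal_superalgebra A"
    and "lie_conformal_superalgebra B"
    and "finite_lcs A"
    and "simple_lcs A"
    and "lcs_triple_hom A B f"
    and "centerless B (enveloping B (range f))"
    and "sum_of_indecomposable_ideals B (enveloping B (range f))"
  shows "lcs_hom A B f \<or> lcs_anti_hom A B f \<or>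
    (\<exists>f1 f2. lcs_hom A B f1 \<and> lcs_anti_hom A B f2 \<and> direct_sum_map B f f1 f2)"
proof -
  obtain d where "\<And>i. f ` part A i \<subseteq> part B (i + d)"
    using assms(5) unfolding lcs_triple_hom_def homogeneous_del_hom_def by blast
  with assms have triple_hom: "centerless_triple_hom A B f d"
    by (simp add: centerless_triple_hom_def centerless_triple_hom_axioms_def)
  show ?thesis
  proof (cases d)
    case zero
    with triple_hom interpret even_triple_hom A B f
      by (simp add: even_triple_hom_def)
    show ?thesis
      using lcs_hom_half_sum lcs_anti_hom_half_sum direct_sum_map_half_sums by blast
  next
    case one
    with triple_hom interpret odd_triple_hom A B f
      by (simp add: odd_triple_hom_def)
    show ?thesis
      using lcs_hom_f by blast
  qed
qed

end
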